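(* Let $k\ge 1$ be an integer. The $2^{2k}$ generators $e_\mu$ of the Clifford algebra $Cl(\mathbb{C}^{2k})$ give a total of exactly $2^{k+1}$ distinct involutions on the group $J_2^{S_{\Delta_{2k}}}$ of 2-torsion points. That is, each map $\vec v\mapsto \rho(e_\mu)\vec v$ on $J_2^{S_{\Delta_{2k}}}$ is an involution, and the set of maps $\{\vec v\mapsto \rho(e_\mu)\vec v\ :\ \mu \text{ a strictly increasing sequence in } \{1,\dots,2k\}\}$ has exactly $2^{k+1}$ elements.
   Context: Clifford algebra: $Cl(\mathbb{C}^{2k})$ is the unital associative complex algebra generated by $e_1,\dots,e_{2k}$ with $e_j^2=-1$ and $e_je_l=-e_le_j$ for $j\neq l$. For a finite sequence $\mu=(i_1,\dots,i_l)$ in $\{1,\dots,2k\}$ put $e_\mu=e_{i_1}\cdots e_{i_l}$, with $e_\emptyset=1$. The generators of the Clifford algebra are the $2^{2k}$ elements $e_\mu$ with $\mu$ strictly increasing (including $\mu=\emptyset$). Representation: let $E_1=\begin{pmatrix} i&0\\0&-i\end{pmatrix}$, $E_2=\begin{pmatrix}0&i\\i&0\end{pmatrix}$, $B=\begin{pmatrix}0&-i\\i&0\end{pmatrix}$, and $I_2$ the $2\times2$ identity. The algebra isomorphism $\rho:Cl(\mathbb{C}^{2k})\to \mathrm{Mat}_{2^k}(\mathbb{C})$ is determined by $\rho(e_{2j-1})=I_2^{\otimes (k-j)}\otimes E_1\otimes B^{\otimes (j-1)}$ and $\rho(e_{2j})=I_2^{\otimes (k-j)}\otimes E_2\otimes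 B^{\otimes (j-1)}$ for $1\le j\le k$, where $\otimes$ is the Kronecker product (the block matrix $M\otimes N$ has blocks $m_{ab}N$). Torus: $S_{\Delta_{2k}}=\mathbb{C}^{2^k}/(\mathbb{Z}^{2^k}\oplus i\mathbb{Z}^{2^k})$, and $J_2^{S_{\Delta_{2k}}}=\{x\in S_{\Delta_{2k}}:2x=0\}$. The matrices $\rho(e_\mu)$ have entries in $\mathbb{Z}[i]$, so they act on $S_{\Delta_{2k}}$ and on $J_2^{S_{\Delta_{2k}}}$. An involution here means a map whose square is the identity; the identity map is included in the count. *)

theory Defs
  imports
    "HOL-Algebra.QuotRing"
    "HOL-Library.Poly_Mapping"
    "Jordan_Normal_Form.Matrix"
begin

section \<open>The Clifford algebra by generators and relations\<close>

datatype gword = GWord (letters: "nat list")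

instantiation gword :: monoid_add
begin

definition zero_gword :: gword where
  "0 = GWord []"

definition plus_gword :: "gword \<Rightarrow> gword \<Rightarrow> gword" where
  "u + v = GWord (letters u @ letters v)"

instance
  by standard (auto simp: zero_gword_def plus_gword_def)

end

lemma letters_zero [simp]: "letters 0 = []"
  by (simp add: zero_gword_def)

lemma letters_plus [simp]: "letters (u + v) = letters u @ letters v"
  by (simp add: plus_gword_def)

text \<open>
  Words form a monoid under concatenation (written additively), so the convolution product of
  \<^typ>\<open>gword \<Rightarrow>\<^sub>0 complex\<close> is that of the free associative algebra.  The carrier below
  consists of the noncommutative polynomials in the letters \<open>1, \<dots>, n\<close>.
\<close>

definition free_alg :: "nat \<Rightarrow> (gword \<Rightarrow>\<^sub>0 complex) ring" where
  "free_alg n =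
     \<lparr>carrier = {p. \<forall>w\<in>Poly_Mapping.keys p. set (letters w) \<subseteq> {1..n}},
      monoid.mult = (*), one = 1, zero = 0, add = (+)\<rparr>"

definition free_gen :: "nat \<Rightarrow> (gword \<Rightarrow>\<^sub>0 complex)" where
  "free_gen j = Poly_Mapping.single (GWord [j]) 1"

definition clifford_relations :: "nat \<Rightarrow> (gword \<Rightarrow>\<^sub>0 complex) set" where
  "clifford_relations n =
     {free_gen j * free_gen j + 1 |j. j \<in> {1..n}} \<union>
     {free_gen j * free_gen l + free_gen l * free_gen j |j l. j \<in> {1..n} \<and> l \<in> {1..n} \<and> j \<noteq> l}"

definition clifford_ideal :: "nat \<Rightarrow> (gword \<Rightarrow>\<^sub>0 complex) set" where
  "clifford_ideal n = Idl\<^bsub>free_alg n\<^esub> (clifford_relations n)"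

definition clifford :: "nat \<Rightarrow> (gword \<Rightarrow>\<^sub>0 complex) set ring" where
  "clifford n = free_alg n Quot clifford_ideal n"

text \<open>The complex scalars inside \<^term>\<open>clifford n\<close>; they give its complex algebra structure.\<close>

definition clifford_scalar :: "nat \<Rightarrow> complex \<Rightarrow> (gword \<Rightarrow>\<^sub>0 complex) set" where
  "clifford_scalar n c = clifford_ideal n +>\<^bsub>free_alg n\<^esub> Poly_Mapping.single 0 c"

definition clifford_gen :: "nat \<Rightarrow> nat \<Rightarrow> (gword \<Rightarrow>\<^sub>0 complex) set" where
  "clifford_gen n j = clifford_ideal n +>\<^bsub>free_alg n\<^esub> free_gen j"

definition clifford_prod :: "nat \<Rightarrow> nat list \<Rightarrow> (gword \<Rightarrow>\<^sub>0 complex) set" where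
  "clifford_prod n \<mu> =
     foldr (\<lambda>j x. clifford_gen n j \<otimes>\<^bsub>clifford n\<^esub> x) \<mu> \<one>\<^bsub>clifford n\<^esub>"


section \<open>The spin representation\<close>

definition kron :: "'a::times mat \<Rightarrow> 'a mat \<Rightarrow> 'a mat" where
  "kron M N = mat (dim_row M * dim_row N) (dim_col M * dim_col N)
     (\<lambda>(a, b). M $$ (a div dim_row N, b div dim_col N) * N $$ (a mod dim_row N, b mod dim_col N))"

fun kron_pow :: "'a::semiring_1 mat \<Rightarrow> nat \<Rightarrow> 'a mat" where
  "kron_pow M 0 = 1\<^sub>m 1"
| "kron_pow M (Suc n) = kron M (kron_pow M n)"

definition E1_mat :: "complex mat" where
  "E1_mat = mat_of_rows_list 2 [[\<i>, 0], [0, - \<i>]]"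

definition E2_mat :: "complex mat" where
  "E2_mat = mat_of_rows_list 2 [[0, \<i>], [\<i>, 0]]"

definition B_mat :: "complex mat" where
  "B_mat = mat_of_rows_list 2 [[0, - \<i>], [\<i>, 0]]"

text \<open>Both \<open>m = 2 * j - 1\<close> and \<open>m = 2 * j\<close> satisfy \<open>(m + 1) div 2 = j\<close>.\<close>

definition spin_gen :: "nat \<Rightarrow> nat \<Rightarrow> complex mat" where
  "spin_gen k m =
     (let j = (m + 1) div 2 in
      kron (kron_pow (1\<^sub>m 2) (k - j))
        (kron (if odd m then E1_mat else E2_mat) (kron_pow B_mat (j - 1))))"

definition spin_word :: "nat \<Rightarrow> nat list \<Rightarrow> complex mat" where
  "spin_word k \<mu> = foldr (\<lambda>m M. spin_gen k m * M) \<mu> (1\<^sub>m (2 ^ k))"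

text \<open>The linear extension of \<^const>\<open>spin_word\<close> to noncommutative polynomials.\<close>

definition spin_eval :: "nat \<Rightarrow> (gword \<Rightarrow>\<^sub>0 complex) \<Rightarrow> complex mat" where
  "spin_eval k p = mat (2 ^ k) (2 ^ k)
     (\<lambda>ab. \<Sum>w\<in>Poly_Mapping.keys p. Poly_Mapping.lookup p w * spin_word k (letters w) $$ ab)"

text \<open>
  The map induced by \<^const>\<open>spin_eval\<close> on the quotient; it is constant on each coset, see
  \<open>spin_rep_coset\<close> below.
\<close>

definition spin_rep :: "nat \<Rightarrow> (gword \<Rightarrow>\<^sub>0 complex) set \<Rightarrow> complex mat" where
  "spin_rep k X = the_elem (spin_eval k ` X)"


section \<open>The torus and its 2-torsion points\<close>

definition gaussian_lattice :: "nat \<Rightarrow> complex vec set" where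
  "gaussian_lattice n = {v \<in> carrier_vec n. \<forall>a<n. Re (v $ a) \<in> \<int> \<and> Im (v $ a) \<in> \<int>}"

definition spin_torus :: "nat \<Rightarrow> complex vec set monoid" where
  "spin_torus k = monoid_vec TYPE(complex) (2 ^ k) Mod gaussian_lattice (2 ^ k)"

definition two_torsion :: "('a, 'b) monoid_scheme \<Rightarrow> 'a set" where
  "two_torsion G = {x \<in> carrier G. x [^]\<^bsub>G\<^esub> (2::nat) = \<one>\<^bsub>G\<^esub>}"

text \<open>
  Points of the torus are cosets of the lattice.  A matrix with Gaussian integer entries sends the
  coset of \<open>v\<close> to the coset of \<open>M *\<^sub>v v\<close>; the union is over equal cosets, see
  \<open>torus_act_coset\<close> below.
\<close>

definition torus_act :: "nat \<Rightarrow> complex mat \<Rightarrow> complex vec set \<Rightarrow> complex vec set" where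
  "torus_act k M X =
     (\<Union>v\<in>X. gaussian_lattice (2 ^ k) #>\<^bsub>monoid_vec TYPE(complex) (2 ^ k)\<^esub> (M *\<^sub>v v))"

definition increasing_seqs :: "nat \<Rightarrow> nat list set" where
  "increasing_seqs n = {\<mu>. sorted_wrt (<) \<mu> \<and> set \<mu> \<subseteq> {1..n}}"

definition clifford_map :: "nat \<Rightarrow> nat list \<Rightarrow> complex vec set \<Rightarrow> complex vec set" where
  "clifford_map k \<mu> =
     restrict (torus_act k (spin_rep k (clifford_prod (2 * k) \<mu>))) (two_torsion (spin_torus k))"

definition involution_on :: "'a set \<Rightarrow> ('a \<Rightarrow> 'a) \<Rightarrow> bool" where
  "involution_on A f \<longleftrightarrow> f \<in> A \<rightarrow> A \<and> (\<forall>x\<in>A. f (f x) = x)"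


section \<open>The algebra presented above is a ring\<close>

lemma free_alg_simps:
  "carrier (free_alg n) = {p. \<forall>w\<in>Poly_Mapping.keys p. set (letters w) \<subseteq> {1..n}}"
  "monoid.mult (free_alg n) = (*)" "one (free_alg n) = 1"
  "zero (free_alg n) = 0" "add (free_alg n) = (+)"
  by (simp_all add: free_alg_def)

lemma free_alg_mult_closed:
  assumes "p \<in> carrier (free_alg n)" "q \<in> carrier (free_alg n)"
  shows "p * q \<in> carrier (free_alg n)"
proof -
  have "set (letters w) \<subseteq> {1..n}" if "w \<in> Poly_Mapping.keys (p * q)" for w
  proof -
    from that keys_mult[of p q] obtain u v
      where "w = u + v" "u \<in> Poly_Mapping.keys p" "v \<in> Poly_Mapping.keys q"
      by blast
    with assms show ?thesis
      by (auto simp: free_alg_simps)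
  qed
  then show ?thesis
    by (simp add: free_alg_simps)
qed

lemma free_alg_add_closed:
  assumes "p \<in> carrier (free_alg n)" "q \<in> carrier (free_alg n)"
  shows "p + q \<in> carrier (free_alg n)"
  using assms keys_add[of p q] by (auto simp: free_alg_simps)

lemma free_alg_single: "set (letters w) \<subseteq> {1..n} \<Longrightarrow> Poly_Mapping.single w c \<in> carrier (free_alg n)"
  by (simp add: free_alg_simps)

lemma free_alg_one: "1 \<in> carrier (free_alg n)"
  using free_alg_single[of 0 n 1] by simp

lemma free_gen_closed: "j \<in> {1..n} \<Longrightarrow> free_gen j \<in> carrier (free_alg n)"
  unfolding free_gen_def by (rule free_alg_single) simp

lemma ring_free_alg: "ring (free_alg n)"
proof (rule ringI)
  show "abelian_group (free_alg n)"
  proof (rule abelian_groupI)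
    fix x assume "x \<in> carrier (free_alg n)"
    then show "\<exists>y\<in>carrier (free_alg n). y \<oplus>\<^bsub>free_alg n\<^esub> x = \<zero>\<^bsub>free_alg n\<^esub>"
      by (intro bexI[of _ "- x"]) (auto simp: free_alg_simps)
  qed (auto intro: free_alg_add_closed simp: free_alg_simps(2-) ac_simps, simp add: free_alg_simps)
  show "Group.monoid (free_alg n)"
    by (rule monoidI) (auto intro: free_alg_mult_closed free_alg_one simp: free_alg_simps(2-) mult.assoc)
qed (auto simp: free_alg_simps(2-) distrib_left distrib_right)

lemma clifford_relations_closed: "clifford_relations n \<subseteq> carrier (free_alg n)"
  unfolding clifford_relations_def
  by (auto intro!: free_alg_add_closed free_alg_mult_closed free_gen_closed free_alg_one)

lemma ideal_clifford_ideal: "ideal (clifford_ideal n) (free_alg n)"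
  unfolding clifford_ideal_def
  by (rule ring.genideal_ideal[OF ring_free_alg clifford_relations_closed])

lemma ring_clifford: "ring (clifford n)"
  unfolding clifford_def by (rule ideal.quotient_is_ring[OF ideal_clifford_ideal])


section \<open>The spin representation is a well-defined unital algebra homomorphism\<close>

lemma kron_carrier [intro, simp]:
  "M \<in> carrier_mat a b \<Longrightarrow> N \<in> carrier_mat c d \<Longrightarrow> kron M N \<in> carrier_mat (a * c) (b * d)"
  by (auto simp: kron_def)

lemma index_kron:
  assumes "M \<in> carrier_mat a b" "N \<in> carrier_mat c d" "i < a * c" "j < b * d"
  shows "kron M N $$ (i, j) = M $$ (i div c, j div d) * N $$ (i mod c, j mod d)"
  using assms by (auto simp: kron_def)

lemma div_less_of_mult: "(i::nat) < a * c \<Longrightarrow> i div c < a"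
  by (simp add: less_mult_imp_div_less)

lemma mod_less_of_mult: "(i::nat) < a * c \<Longrightarrow> i mod c < c"
  by (cases "c = 0") auto

lemma sum_div_mod:
  fixes f :: "nat \<Rightarrow> nat \<Rightarrow> 'a::comm_monoid_add"
  shows "(\<Sum>c = 0..<m * n. f (c div n) (c mod n)) = (\<Sum>a = 0..<m. \<Sum>b = 0..<n. f a b)"
proof -
  have "(\<Sum>c<m * n. f (c div n) (c mod n)) = (\<Sum>a<m. \<Sum>c = a * n..<a * n + n. f (c div n) (c mod n))"
    by (rule sum.nat_group[symmetric])
  also have "\<dots> = (\<Sum>a<m. \<Sum>b<n. f a b)"
  proof (rule sum.cong[OF refl])
    fix a
    show "(\<Sum>c = a * n..<a * n + n. f (c div n) (c mod n)) = (\<Sum>b<n. f a b)"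
      unfolding sum.atLeastLessThan_shift_0[of _ "a * n"]
      by (intro sum.cong) auto
  qed
  finally show ?thesis
    by (simp add: lessThan_atLeast0)
qed

lemma kron_mult:
  fixes M :: "'a::comm_semiring_1 mat"
  assumes M: "M \<in> carrier_mat a b" and N: "N \<in> carrier_mat c d"
    and P: "P \<in> carrier_mat b e" and Q: "Q \<in> carrier_mat d f"
  shows "kron M N * kron P Q = kron (M * P) (N * Q)"
proof (rule eq_matI)
  have MP: "M * P \<in> carrier_mat a e" and NQ: "N * Q \<in> carrier_mat c f"
    using assms by auto
  show "dim_row (kron M N * kron P Q) = dim_row (kron (M * P) (N * Q))"
    and "dim_col (kron M N * kron P Q) = dim_col (kron (M * P) (N * Q))"
    using assms by (auto simp: kron_def)
  fix i j
  assume "i < dim_row (kron (M * P) (N * Q))" "j < dim_col (kron (M * P) (N * Q))"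
  then have i: "i < a * c" and j: "j < e * f"
    using assms by (auto simp: kron_def)
  note ij = i j div_less_of_mult[OF i] div_less_of_mult[OF j] mod_less_of_mult[OF i] mod_less_of_mult[OF j]
  have KM: "kron M N \<in> carrier_mat (a * c) (b * d)" and KP: "kron P Q \<in> carrier_mat (b * d) (e * f)"
    using assms by auto
  have "(kron M N * kron P Q) $$ (i, j)
      = (\<Sum>x = 0..<b * d. kron M N $$ (i, x) * kron P Q $$ (x, j))"
    using KM KP ij by (simp add: scalar_prod_def)
  also have "\<dots> = (\<Sum>x = 0..<b * d. (M $$ (i div c, x div d) * P $$ (x div d, j div f)) *
      (N $$ (i mod c, x mod d) * Q $$ (x mod d, j mod f)))"
    using assms ij by (intro sum.cong refl) (simp add: index_kron[OF M N] index_kron[OF P Q] ac_simps)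
  also have "\<dots> = (\<Sum>x = 0..<b. \<Sum>y = 0..<d. (M $$ (i div c, x) * P $$ (x, j div f)) *
      (N $$ (i mod c, y) * Q $$ (y, j mod f)))"
    by (rule sum_div_mod)
  also have "\<dots> = (M * P) $$ (i div c, j div f) * (N * Q) $$ (i mod c, j mod f)"
    using assms ij by (simp add: scalar_prod_def sum_product)
  also have "\<dots> = kron (M * P) (N * Q) $$ (i, j)"
    using ij by (simp add: index_kron[OF MP NQ])
  finally show "(kron M N * kron P Q) $$ (i, j) = kron (M * P) (N * Q) $$ (i, j)" .
qed

lemma kron_uminus_left:
  fixes M :: "'a::comm_ring_1 mat"
  shows "kron (- M) N = - kron M N"
  by (rule eq_matI) (auto simp: kron_def div_less_of_mult)

lemma kron_uminus_right:
  fixes M :: "'a::comm_ring_1 mat"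
  shows "kron M (- N) = - kron M N"
  by (rule eq_matI) (auto simp: kron_def mod_less_of_mult)

lemma kron_one: "kron (1\<^sub>m a) (1\<^sub>m c) = (1\<^sub>m (a * c) :: 'a::semiring_1 mat)"
proof (rule eq_matI)
  fix i j
  assume "i < dim_row (1\<^sub>m (a * c) :: 'a mat)" "j < dim_col (1\<^sub>m (a * c) :: 'a mat)"
  then have i: "i < a * c" and j: "j < a * c" by auto
  have "i = j \<longleftrightarrow> i div c = j div c \<and> i mod c = j mod c"
    by (metis div_mult_mod_eq)
  then show "kron (1\<^sub>m a) (1\<^sub>m c) $$ (i, j) = (1\<^sub>m (a * c) :: 'a mat) $$ (i, j)"
    using i j by (auto simp: kron_def div_less_of_mult mod_less_of_mult)
qed (auto simp: kron_def)

lemma kron_one_left: "kron (1\<^sub>m 1) M = (M :: 'a::semiring_1 mat)"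
  by (rule eq_matI) (auto simp: kron_def)

lemma kron_assoc:
  fixes M :: "'a::comm_semiring_1 mat"
  shows "kron (kron M N) P = kron M (kron N P)"
proof (rule eq_matI)
  fix i j
  assume "i < dim_row (kron M (kron N P))" "j < dim_col (kron M (kron N P))"
  then have i: "i < dim_row M * (dim_row N * dim_row P)" and j: "j < dim_col M * (dim_col N * dim_col P)"
    by (auto simp: kron_def)
  have d: "x div c < m * n" "x mod (n * c) < n * c" "x div c div n = x div (n * c)"
      "x div (n * c) < m" "x mod (n * c) div c = x div c mod n" "x mod (n * c) mod c = x mod c"
    if "x < m * (n * c)" for x m n c :: nat
  proof -
    show "x div c < m * n"
      using that by (intro div_less_of_mult) (simp add: mult.assoc)
    show "x mod (n * c) < n * c"
      using that by (rule mod_less_of_mult)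
    show "x div c div n = x div (n * c)"
      by (simp add: div_mult2_eq mult.commute[of n c])
    show "x div (n * c) < m"
      using that by (rule div_less_of_mult)
    show "x mod (n * c) div c = x div c mod n"
      using that by (cases "c = 0") (auto simp: mod_mult2_eq mult.commute[of n c])
    show "x mod (n * c) mod c = x mod c"
      by (simp add: mod_mult2_eq mult.commute[of n c])
  qed
  show "kron (kron M N) P $$ (i, j) = kron M (kron N P) $$ (i, j)"
    using i j d[OF i] d[OF j] by (simp add: kron_def mult.assoc)
qed (auto simp: kron_def)

lemma kron_pow_carrier: "M \<in> carrier_mat 2 2 \<Longrightarrow> kron_pow M n \<in> carrier_mat (2 ^ n) (2 ^ n)"
  by (induction n) auto

lemma kron_pow_one: "kron_pow (1\<^sub>m 2) n = (1\<^sub>m (2 ^ n) :: 'a::semiring_1 mat)"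
  by (induction n) (auto simp: kron_one)

lemma spin_blocks_carrier [simp]:
  "E1_mat \<in> carrier_mat 2 2" "E2_mat \<in> carrier_mat 2 2" "B_mat \<in> carrier_mat 2 2"
  by (auto simp: E1_mat_def E2_mat_def B_mat_def mat_of_rows_list_def)

lemma spin_blocks:
  "E1_mat * E1_mat = - 1\<^sub>m 2" "E2_mat * E2_mat = - 1\<^sub>m 2" "B_mat * B_mat = 1\<^sub>m 2"
  "E1_mat * E2_mat = - (E2_mat * E1_mat)" "E2_mat * E1_mat = - (E1_mat * E2_mat)"
  "B_mat * E1_mat = - (E1_mat * B_mat)" "B_mat * E2_mat = - (E2_mat * B_mat)"
  by (rule eq_matI; auto simp: E1_mat_def E2_mat_def B_mat_def mat_of_rows_list_def scalar_prod_def
      numeral_2_eq_2 less_Suc_eq)+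

text \<open>The letters \<open>1, \<dots>, 2 * k + 2\<close> for \<open>k + 1\<close> are those for \<open>k\<close> together with two new ones.\<close>

abbreviation spin_block :: "nat \<Rightarrow> complex mat" where
  "spin_block m \<equiv> (if odd m then E1_mat else E2_mat)"

lemma spin_gen_Suc:
  assumes "m \<in> {1..2 * k}"
  shows "spin_gen (Suc k) m = kron (1\<^sub>m 2) (spin_gen k m)"
proof -
  have "Suc k - (m + 1) div 2 = Suc (k - (m + 1) div 2)"
    using assms by auto
  then show ?thesis
    by (simp add: spin_gen_def Let_def kron_assoc)
qed

lemma spin_gen_top:
  assumes "m \<in> {2 * k + 1..2 * Suc k}"
  shows "spin_gen (Suc k) m = kron (spin_block m) (kron_pow B_mat k)"
proof -
  have "(m + 1) div 2 = Suc k"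
    using assms by auto
  then show ?thesis
    by (simp add: spin_gen_def kron_one_left[unfolded One_nat_def])
qed

lemma spin_gen_cases:
  assumes "m \<in> {1..2 * Suc k}"
  obtains "m \<in> {1..2 * k}" | "m \<in> {2 * k + 1..2 * Suc k}"
  using assms by fastforce

lemma spin_gen_carrier: "m \<in> {1..2 * k} \<Longrightarrow> spin_gen k m \<in> carrier_mat (2 ^ k) (2 ^ k)"
proof (induction k)
  case (Suc k)
  from Suc.prems show ?case
    by (cases rule: spin_gen_cases)
      (use Suc.IH kron_pow_carrier[of B_mat k] in \<open>auto simp: spin_gen_Suc spin_gen_top simp del: mult_Suc_right\<close>)
qed auto

lemma B_pow_sq: "kron_pow B_mat k * kron_pow B_mat k = 1\<^sub>m (2 ^ k)"
proof (induction k)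
  case (Suc k)
  have c: "kron_pow B_mat k \<in> carrier_mat (2 ^ k) (2 ^ k)"
    by (simp add: kron_pow_carrier)
  show ?case
    by (simp add: kron_mult[OF spin_blocks_carrier(3) c spin_blocks_carrier(3) c] Suc.IH spin_blocks kron_one)
qed auto

lemma spin_block_carrier: "spin_block m \<in> carrier_mat 2 2"
  by simp

lemma spin_block_rels:
  "spin_block m * spin_block m = - 1\<^sub>m 2"
  "B_mat * spin_block m = - (spin_block m * B_mat)"
  "odd m \<noteq> odd l \<Longrightarrow> spin_block m * spin_block l = - (spin_block l * spin_block m)"
  by (simp_all add: spin_blocks(1,2,6,7)) (auto simp: spin_blocks(4) uminus_uminus_mat)

lemma B_pow_spin_gen:
  "m \<in> {1..2 * k} \<Longrightarrow> kron_pow B_mat k * spin_gen k m = - (spin_gen k m * kron_pow B_mat k)"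
proof (induction k)
  case (Suc k)
  have c: "kron_pow B_mat k \<in> carrier_mat (2 ^ k) (2 ^ k)"
    by (simp add: kron_pow_carrier)
  have o: "1\<^sub>m 2 \<in> carrier_mat 2 2" by simp
  from Suc.prems show ?case
  proof (cases rule: spin_gen_cases)
    case 1
    note g = spin_gen_carrier[OF 1]
    show ?thesis
      by (simp add: spin_gen_Suc[OF 1] kron_mult[OF spin_blocks_carrier(3) c o g]
          kron_mult[OF o g spin_blocks_carrier(3) c] Suc.IH[OF 1] kron_uminus_right
          left_mult_one_mat[OF spin_blocks_carrier(3)] right_mult_one_mat[OF spin_blocks_carrier(3)])
  next
    case 2
    show ?thesis
      unfolding spin_gen_top[OF 2] kron_pow.simps
        kron_mult[OF spin_blocks_carrier(3) c spin_block_carrier c]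
        kron_mult[OF spin_block_carrier c spin_blocks_carrier(3) c]
        spin_block_rels(2) kron_uminus_left ..
  qed
qed auto

lemma spin_gen_sq: "m \<in> {1..2 * k} \<Longrightarrow> spin_gen k m * spin_gen k m = - 1\<^sub>m (2 ^ k)"
proof (induction k)
  case (Suc k)
  have c: "kron_pow B_mat k \<in> carrier_mat (2 ^ k) (2 ^ k)"
    by (simp add: kron_pow_carrier)
  have o: "1\<^sub>m 2 \<in> carrier_mat 2 2" by simp
  from Suc.prems show ?case
  proof (cases rule: spin_gen_cases)
    case 1
    note g = spin_gen_carrier[OF 1]
    show ?thesis
      by (simp add: spin_gen_Suc[OF 1] kron_mult[OF o g o g] Suc.IH[OF 1] kron_uminus_right kron_one)
  next
    case 2
    show ?thesis
      unfolding spin_gen_top[OF 2] kron_mult[OF spin_block_carrier c spin_block_carrier c]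
        spin_block_rels(1) kron_uminus_left B_pow_sq kron_one power_Suc ..
  qed
qed auto

lemma spin_gen_anticomm_less:
  "m \<in> {1..2 * k} \<Longrightarrow> l \<in> {1..2 * k} \<Longrightarrow> m < l \<Longrightarrow>
     spin_gen k m * spin_gen k l = - (spin_gen k l * spin_gen k m)"
proof (induction k)
  case (Suc k)
  have c: "kron_pow B_mat k \<in> carrier_mat (2 ^ k) (2 ^ k)"
    by (simp add: kron_pow_carrier)
  have o: "1\<^sub>m 2 \<in> carrier_mat 2 2" by simp
  from Suc.prems(2) show ?case
  proof (cases rule: spin_gen_cases)
    case 1
    then have 2: "m \<in> {1..2 * k}"
      using Suc.prems by auto
    note g = spin_gen_carrier[OF 1] spin_gen_carrier[OF 2]
    show ?thesis
      by (simp add: spin_gen_Suc[OF 1] spin_gen_Suc[OF 2] kron_mult[OF o g(2) o g(1)]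
          kron_mult[OF o g(1) o g(2)] Suc.IH[OF 2 1 Suc.prems(3)] kron_uminus_right)
  next
    case l: 2
    from Suc.prems(1) show ?thesis
    proof (cases rule: spin_gen_cases)
      case 1
      note g = spin_gen_carrier[OF 1]
      show ?thesis
        unfolding spin_gen_Suc[OF 1] spin_gen_top[OF l] kron_mult[OF o g spin_block_carrier c]
          kron_mult[OF spin_block_carrier c o g] B_pow_spin_gen[OF 1] kron_uminus_right
          left_mult_one_mat[OF spin_block_carrier] right_mult_one_mat[OF spin_block_carrier]
          uminus_uminus_mat ..
    next
      case 2
      then have "odd m \<noteq> odd l"
        using l Suc.prems(3) by (auto simp: le_Suc_eq)
      then show ?thesis
        unfolding spin_gen_top[OF 2] spin_gen_top[OF l]
          kron_mult[OF spin_block_carrier c spin_block_carrier c]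
        by (metis spin_block_rels(3) kron_uminus_left)
    qed
  qed
qed auto

lemma spin_gen_anticomm:
  assumes "m \<in> {1..2 * k}" "l \<in> {1..2 * k}" "m \<noteq> l"
  shows "spin_gen k m * spin_gen k l = - (spin_gen k l * spin_gen k m)"
  using spin_gen_anticomm_less[OF assms(1,2)] spin_gen_anticomm_less[OF assms(2,1)] assms(3)
  by (metis nat_neq_iff uminus_uminus_mat)

lemma spin_word_carrier: "set \<mu> \<subseteq> {1..2 * k} \<Longrightarrow> spin_word k \<mu> \<in> carrier_mat (2 ^ k) (2 ^ k)"
  by (induction \<mu>) (auto simp: spin_word_def intro!: mult_carrier_mat[OF spin_gen_carrier])

lemma spin_word_append:
  assumes "set \<mu> \<subseteq> {1..2 * k}" "set \<nu> \<subseteq> {1..2 * k}"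
  shows "spin_word k (\<mu> @ \<nu>) = spin_word k \<mu> * spin_word k \<nu>"
  using assms(1)
proof (induction \<mu>)
  case Nil
  then show ?case
    using spin_word_carrier[OF assms(2)] by (simp add: spin_word_def)
next
  case (Cons m \<mu>)
  have "spin_word k ((m # \<mu>) @ \<nu>) = spin_gen k m * spin_word k (\<mu> @ \<nu>)"
    by (simp add: spin_word_def)
  also have "\<dots> = spin_gen k m * (spin_word k \<mu> * spin_word k \<nu>)"
    using Cons by simp
  also have "\<dots> = spin_gen k m * spin_word k \<mu> * spin_word k \<nu>"
    using Cons.prems assms(2)
    by (intro assoc_mult_mat[symmetric, of _ "2 ^ k" "2 ^ k" _ "2 ^ k" _ "2 ^ k"]
        spin_word_carrier spin_gen_carrier) auto
  also have "spin_gen k m * spin_word k \<mu> = spin_word k (m # \<mu>)"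
    by (simp add: spin_word_def)
  finally show ?case .
qed

lemma spin_eval_carrier [simp]: "spin_eval k p \<in> carrier_mat (2 ^ k) (2 ^ k)"
  by (simp add: spin_eval_def)

lemma spin_eval_index_superset:
  assumes "finite A" "Poly_Mapping.keys p \<subseteq> A" "i < 2 ^ k" "j < 2 ^ k"
  shows "spin_eval k p $$ (i, j) =
    (\<Sum>w\<in>A. Poly_Mapping.lookup p w * spin_word k (letters w) $$ (i, j))"
proof -
  have "(\<Sum>w\<in>Poly_Mapping.keys p. Poly_Mapping.lookup p w * spin_word k (letters w) $$ (i, j)) =
    (\<Sum>w\<in>A. Poly_Mapping.lookup p w * spin_word k (letters w) $$ (i, j))"
    using assms(1,2) by (intro sum.mono_neutral_left) (auto simp: in_keys_iff)
  then show ?thesis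
    using assms(3,4) by (simp add: spin_eval_def)
qed

lemma spin_eval_add: "spin_eval k (p + q) = spin_eval k p + spin_eval k q"
proof (rule eq_matI)
  fix i j
  assume "i < dim_row (spin_eval k p + spin_eval k q)" "j < dim_col (spin_eval k p + spin_eval k q)"
  then have ij: "i < 2 ^ k" "j < 2 ^ k"
    by (auto simp: spin_eval_def)
  let ?A = "Poly_Mapping.keys p \<union> Poly_Mapping.keys q"
  have "finite ?A" by simp
  note s = spin_eval_index_superset[OF this _ ij]
  have "spin_eval k (p + q) $$ (i, j) = spin_eval k p $$ (i, j) + spin_eval k q $$ (i, j)"
    using s[of "p + q"] s[of p] s[of q] keys_add[of p q]
    by (simp add: lookup_add sum.distrib distrib_right)
  then show "spin_eval k (p + q) $$ (i, j) = (spin_eval k p + spin_eval k q) $$ (i, j)"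
    using ij by (simp add: spin_eval_def)
qed (auto simp: spin_eval_def)

lemma spin_eval_single:
  assumes "set (letters w) \<subseteq> {1..2 * k}"
  shows "spin_eval k (Poly_Mapping.single w c) = c \<cdot>\<^sub>m spin_word k (letters w)"
  by (rule eq_matI) (use spin_word_carrier[OF assms] in \<open>auto simp: spin_eval_def\<close>)

lemma spin_eval_zero: "spin_eval k 0 = 0\<^sub>m (2 ^ k) (2 ^ k)"
  by (rule eq_matI) (auto simp: spin_eval_def)

lemma free_alg_induct [consumes 1, case_names zero single add]:
  assumes "p \<in> carrier (free_alg n)"
    and "P 0"
    and "\<And>w c. set (letters w) \<subseteq> {1..n} \<Longrightarrow> P (Poly_Mapping.single w c)"
    and "\<And>p q. p \<in> carrier (free_alg n) \<Longrightarrow> q \<in> carrier (free_alg n) \<Longrightarrow> P p \<Longrightarrow> P q \<Longrightarrow> P (p + q)"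
  shows "P p"
proof -
  define s where "s A = (\<Sum>w\<in>A. Poly_Mapping.single w (Poly_Mapping.lookup p w))" for A
  have "s A \<in> carrier (free_alg n) \<and> P (s A)" if "finite A" "A \<subseteq> Poly_Mapping.keys p" for A
    using that
  proof (induction A rule: finite_induct)
    case empty
    then show ?case
      using assms(2) by (simp add: s_def free_alg_simps)
  next
    case (insert w A)
    then have "set (letters w) \<subseteq> {1..n}"
      using assms(1) by (auto simp: free_alg_simps)
    then show ?case
      using insert assms(3,4) free_alg_single free_alg_add_closed by (simp add: s_def)
  qed
  then have "P (s (Poly_Mapping.keys p))"
    by simp
  moreover have "s (Poly_Mapping.keys p) = p"
    by (rule poly_mapping_eqI)
      (auto simp: s_def lookup_sum lookup_single when_def in_keys_iff sum.delta)
  ultimately show ?thesis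
    by simp
qed

lemma spin_eval_mult:
  assumes "p \<in> carrier (free_alg (2 * k))" "q \<in> carrier (free_alg (2 * k))"
  shows "spin_eval k (p * q) = spin_eval k p * spin_eval k q"
  using assms(1)
proof (induction rule: free_alg_induct)
  case zero
  then show ?case
    using left_mult_zero_mat[OF spin_eval_carrier[of k q]] by (simp add: spin_eval_zero)
next
  case (add p p')
  then show ?case
    by (simp add: distrib_right spin_eval_add
        add_mult_distrib_mat[OF spin_eval_carrier spin_eval_carrier spin_eval_carrier])
next
  case u: (single u c)
  show ?case
    using assms(2)
  proof (induction rule: free_alg_induct)
    case zero
    then show ?case
      using right_mult_zero_mat[OF spin_eval_carrier[of k]] by (simp add: spin_eval_zero)
  next
    case (add q q')
    then show ?case
      by (simp add: distrib_left spin_eval_add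
          mult_add_distrib_mat[OF spin_eval_carrier spin_eval_carrier spin_eval_carrier])
  next
    case v: (single v d)
    note c = spin_word_carrier[OF u] spin_word_carrier[OF v]
    have "set (letters (u + v)) \<subseteq> {1..2 * k}"
      using u v by simp
    then have "spin_eval k (Poly_Mapping.single u c * Poly_Mapping.single v d) =
        (c * d) \<cdot>\<^sub>m (spin_word k (letters u) * spin_word k (letters v))"
      by (simp add: mult_single spin_eval_single spin_word_append[OF u v])
    also have "\<dots> = (c \<cdot>\<^sub>m spin_word k (letters u)) * (d \<cdot>\<^sub>m spin_word k (letters v))"
      by (rule eq_matI) (use c in auto)
    finally show ?case
      by (simp add: spin_eval_single[OF u] spin_eval_single[OF v])
  qed
qed

lemma spin_eval_one: "spin_eval k 1 = 1\<^sub>m (2 ^ k)"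
proof -
  have "spin_eval k (Poly_Mapping.single 0 1) = 1 \<cdot>\<^sub>m spin_word k (letters 0)"
    by (rule spin_eval_single) simp
  also have "\<dots> = 1\<^sub>m (2 ^ k)"
    by (rule eq_matI) (auto simp: spin_word_def)
  finally show ?thesis by simp
qed

lemma spin_eval_gen:
  assumes "m \<in> {1..2 * k}"
  shows "spin_eval k (free_gen m) = spin_gen k m"
proof -
  have "spin_eval k (free_gen m) = 1 \<cdot>\<^sub>m spin_word k [m]"
    using spin_eval_single[of "GWord [m]" k 1] assms by (simp add: free_gen_def)
  also have "\<dots> = spin_gen k m"
    by (rule eq_matI) (use spin_gen_carrier[OF assms] in \<open>auto simp: spin_word_def\<close>)
  finally show ?thesis .
qed

lemma ring_mat_ring: "ring (ring_mat TYPE(complex) n ())"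
  by (rule ring_mat)

lemma spin_eval_hom: "ring_hom_ring (free_alg (2 * k)) (ring_mat TYPE(complex) (2 ^ k) ()) (spin_eval k)"
  by (rule ring_hom_ringI[OF ring_free_alg ring_mat_ring])
    (auto simp: ring_mat_simps free_alg_simps(2-) spin_eval_add spin_eval_mult spin_eval_one)

lemma clifford_ideal_kernel:
  "clifford_ideal (2 * k) \<subseteq>
     a_kernel (free_alg (2 * k)) (ring_mat TYPE(complex) (2 ^ k) ()) (spin_eval k)"
proof -
  interpret h: ring_hom_ring "free_alg (2 * k)" "ring_mat TYPE(complex) (2 ^ k) ()" "spin_eval k"
    by (rule spin_eval_hom)
  have "spin_eval k p = 0\<^sub>m (2 ^ k) (2 ^ k)" if "p \<in> clifford_relations (2 * k)" for p
    using that unfolding clifford_relations_def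
  proof (elim UnE CollectE exE conjE)
    fix j assume p: "p = free_gen j * free_gen j + 1" and j: "j \<in> {1..2 * k}"
    show ?thesis
      using free_gen_closed[OF j]
      by (simp add: p spin_eval_add spin_eval_mult spin_eval_one spin_eval_gen[OF j] spin_gen_sq[OF j]
          uminus_l_inv_mat[OF one_carrier_mat])
  next
    fix j l
    assume p: "p = free_gen j * free_gen l + free_gen l * free_gen j"
      and j: "j \<in> {1..2 * k}" and l: "l \<in> {1..2 * k}" and "j \<noteq> l"
    note c = mult_carrier_mat[OF spin_gen_carrier[OF l] spin_gen_carrier[OF j]]
    show ?thesis
      using free_gen_closed[OF j] free_gen_closed[OF l]
      by (simp add: p spin_eval_add spin_eval_mult spin_eval_gen[OF j] spin_eval_gen[OF l]
          spin_gen_anticomm[OF j l \<open>j \<noteq> l\<close>] uminus_l_inv_mat[OF c])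
  qed
  then have "clifford_relations (2 * k) \<subseteq>
      a_kernel (free_alg (2 * k)) (ring_mat TYPE(complex) (2 ^ k) ()) (spin_eval k)"
    using clifford_relations_closed[of "2 * k"] unfolding a_kernel_def' ring_mat_simps by blast
  then show ?thesis
    unfolding clifford_ideal_def by (rule h.R.genideal_minimal[OF h.kernel_is_ideal])
qed

lemma spin_rep_coset:
  assumes "p \<in> carrier (free_alg (2 * k))"
  shows "spin_rep k (clifford_ideal (2 * k) +>\<^bsub>free_alg (2 * k)\<^esub> p) = spin_eval k p"
proof -
  interpret I: ideal "clifford_ideal (2 * k)" "free_alg (2 * k)"
    by (rule ideal_clifford_ideal)
  have "spin_eval k q = spin_eval k p"
    if q: "q \<in> clifford_ideal (2 * k) +>\<^bsub>free_alg (2 * k)\<^esub> p" for q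
  proof -
    from q obtain h where h: "h \<in> clifford_ideal (2 * k)" and "q = h + p"
      by (auto simp: a_r_coset_def' free_alg_simps)
    then show ?thesis
      using clifford_ideal_kernel[of k] left_add_zero_mat[OF spin_eval_carrier[of k p]]
      by (auto simp: spin_eval_add a_kernel_def' ring_mat_simps)
  qed
  moreover have "p \<in> clifford_ideal (2 * k) +>\<^bsub>free_alg (2 * k)\<^esub> p"
    by (rule I.a_rcos_self[OF assms])
  ultimately have "spin_eval k ` (clifford_ideal (2 * k) +>\<^bsub>free_alg (2 * k)\<^esub> p) = {spin_eval k p}"
    by blast
  then show ?thesis
    by (simp only: spin_rep_def the_elem_eq)
qed

lemma spin_rep_hom: "spin_rep k \<in> Ring.ring_hom (clifford (2 * k)) (ring_mat TYPE(complex) (2 ^ k) ())"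
proof -
  interpret I: ideal "clifford_ideal (2 * k)" "free_alg (2 * k)"
    by (rule ideal_clifford_ideal)
  have car: "\<exists>p\<in>carrier (free_alg (2 * k)). X = clifford_ideal (2 * k) +>\<^bsub>free_alg (2 * k)\<^esub> p"
    if "X \<in> carrier (clifford (2 * k))" for X
    using that unfolding clifford_def FactRing_def A_RCOSETS_def' by auto
  show ?thesis
  proof (rule ring_hom_memI)
    fix X Y
    assume X: "X \<in> carrier (clifford (2 * k))"
    then obtain p where p: "p \<in> carrier (free_alg (2 * k))"
      "X = clifford_ideal (2 * k) +>\<^bsub>free_alg (2 * k)\<^esub> p"
      using car by blast
    show "spin_rep k X \<in> carrier (ring_mat TYPE(complex) (2 ^ k) ())"
      using p by (simp add: spin_rep_coset ring_mat_simps)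
    assume "Y \<in> carrier (clifford (2 * k))"
    then obtain q where q: "q \<in> carrier (free_alg (2 * k))"
      "Y = clifford_ideal (2 * k) +>\<^bsub>free_alg (2 * k)\<^esub> q"
      using car by blast
    show "spin_rep k (X \<otimes>\<^bsub>clifford (2 * k)\<^esub> Y) =
        spin_rep k X \<otimes>\<^bsub>ring_mat TYPE(complex) (2 ^ k) ()\<^esub> spin_rep k Y"
      using I.rcoset_mult_add[OF p(1) q(1)] p q free_alg_mult_closed[OF p(1) q(1)]
      by (simp add: clifford_def FactRing_def spin_rep_coset spin_eval_mult ring_mat_simps free_alg_simps(2-))
    show "spin_rep k (X \<oplus>\<^bsub>clifford (2 * k)\<^esub> Y) =
        spin_rep k X \<oplus>\<^bsub>ring_mat TYPE(complex) (2 ^ k) ()\<^esub> spin_rep k Y"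
      using I.a_rcos_sum[OF p(1) q(1)] p q free_alg_add_closed[OF p(1) q(1)]
      by (simp add: clifford_def FactRing_def spin_rep_coset spin_eval_add ring_mat_simps free_alg_simps(2-))
  next
    show "spin_rep k \<one>\<^bsub>clifford (2 * k)\<^esub> = \<one>\<^bsub>ring_mat TYPE(complex) (2 ^ k) ()\<^esub>"
      using spin_rep_coset[OF free_alg_one[of "2 * k"]]
      by (simp add: clifford_def FactRing_def spin_eval_one ring_mat_simps free_alg_simps(2-))
  qed
qed

lemma spin_rep_gen: "m \<in> {1..2 * k} \<Longrightarrow> spin_rep k (clifford_gen (2 * k) m) = spin_gen k m"
  by (simp add: clifford_gen_def spin_rep_coset free_gen_closed spin_eval_gen)

lemma spin_rep_scalar: "spin_rep k (clifford_scalar (2 * k) c) = c \<cdot>\<^sub>m 1\<^sub>m (2 ^ k)"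
proof -
  have "Poly_Mapping.single 0 c \<in> carrier (free_alg (2 * k))"
    by (rule free_alg_single) simp
  moreover have "spin_eval k (Poly_Mapping.single 0 c) = c \<cdot>\<^sub>m spin_word k (letters 0)"
    by (rule spin_eval_single) simp
  ultimately show ?thesis
    by (simp add: clifford_scalar_def spin_rep_coset spin_word_def)
qed


section \<open>The torus action is well defined\<close>

lemma torus_act_coset:
  assumes M: "M \<in> carrier_mat (2 ^ k) (2 ^ k)"
    and gauss: "\<And>a b. a < 2 ^ k \<Longrightarrow> b < 2 ^ k \<Longrightarrow> Re (M $$ (a, b)) \<in> \<int> \<and> Im (M $$ (a, b)) \<in> \<int>"
    and v: "v \<in> carrier_vec (2 ^ k)"
  shows "torus_act k M (gaussian_lattice (2 ^ k) #>\<^bsub>monoid_vec TYPE(complex) (2 ^ k)\<^esub> v) =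
    gaussian_lattice (2 ^ k) #>\<^bsub>monoid_vec TYPE(complex) (2 ^ k)\<^esub> (M *\<^sub>v v)"
proof -
  let ?n = "2 ^ k :: nat"
  let ?L = "gaussian_lattice ?n"
  have coset: "?L #>\<^bsub>monoid_vec TYPE(complex) ?n\<^esub> w = {l + w |l. l \<in> ?L}" for w
    by (auto simp: r_coset_def monoid_vec_simps)
  have L: "l \<in> carrier_vec ?n" if "l \<in> ?L" for l
    using that by (simp add: gaussian_lattice_def)
  have add: "l + l' \<in> ?L" and diff: "l - l' \<in> ?L" if "l \<in> ?L" "l' \<in> ?L" for l l'
    using that by (auto simp: gaussian_lattice_def)
  have Ml: "M *\<^sub>v l \<in> ?L" if "l \<in> ?L" for l
    using that M gauss by (auto simp: gaussian_lattice_def scalar_prod_def Re_sum Im_sum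
        intro!: Ints_sum Ints_add Ints_diff Ints_mult)
  have Mv: "M *\<^sub>v v \<in> carrier_vec ?n"
    using M v by simp
  have dist: "M *\<^sub>v (l + v) = M *\<^sub>v l + M *\<^sub>v v" if "l \<in> ?L" for l
    using M L[OF that] v by (rule mult_add_distrib_mat_vec)
  have "(\<Union>l\<in>?L. {l' + (M *\<^sub>v l + M *\<^sub>v v) |l'. l' \<in> ?L}) = {l + M *\<^sub>v v |l. l \<in> ?L}"
  proof (intro equalityI subsetI)
    fix x assume "x \<in> (\<Union>l\<in>?L. {l' + (M *\<^sub>v l + M *\<^sub>v v) |l'. l' \<in> ?L})"
    then obtain l l' where l: "l \<in> ?L" "l' \<in> ?L" "x = l' + (M *\<^sub>v l + M *\<^sub>v v)"
      by blast
    then have "x = (l' + M *\<^sub>v l) + M *\<^sub>v v"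
      using assoc_add_vec[OF L[OF l(2)] L[OF Ml[OF l(1)]] Mv] by simp
    then show "x \<in> {l + M *\<^sub>v v |l. l \<in> ?L}"
      using add[OF l(2) Ml[OF l(1)]] by blast
  next
    fix x assume "x \<in> {l + M *\<^sub>v v |l. l \<in> ?L}"
    then obtain l where l: "l \<in> ?L" "x = l + M *\<^sub>v v"
      by blast
    have "x = (l - M *\<^sub>v l) + (M *\<^sub>v l + M *\<^sub>v v)"
      by (rule eq_vecI) (use l(2) L[OF l(1)] Mv M in auto)
    then show "x \<in> (\<Union>l\<in>?L. {l' + (M *\<^sub>v l + M *\<^sub>v v) |l'. l' \<in> ?L})"
      using l(1) diff[OF l(1) Ml[OF l(1)]] by blast
  qed
  moreover have "torus_act k M {l + v |l. l \<in> ?L} = (\<Union>l\<in>?L. {l' + M *\<^sub>v (l + v) |l'. l' \<in> ?L})"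
    unfolding torus_act_def coset by blast
  ultimately show ?thesis
    unfolding coset by (simp add: dist)
qed

end

theory Submission
  imports Defs
begin

text \<open>
  Modulo 2 the matrices \<open>E\<^sub>2\<close> and \<open>B\<close> both become \<open>\<i>\<close> times the swap of the two basis vectors,
  and \<open>E\<^sub>1\<close> becomes the scalar \<open>\<i>\<close>.  Hence every \<open>\<rho>(e\<^sub>\<mu>)\<close> acts on the 2-torsion points as
  \<open>\<i>\<^sup>s\<close> times the permutation \<open>b \<mapsto> b XOR m\<close> of the basis vectors, where only the parity of \<open>s\<close>
  matters since \<open>-1 \<equiv> 1\<close>.  These maps are involutions, they are pairwise distinct for
  \<open>m < 2\<^sup>k\<close> and \<open>s \<in> {0, 1}\<close>, and all of them occur: \<open>e\<^sub>1\<close> acts as the scalar \<open>\<i>\<close> and the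
  \<open>e\<^bsub>2j\<^esub>\<close> realise, up to scalars, the masks \<open>2\<^sup>j - 1\<close>, which generate all \<open>m\<close> under XOR.
\<close>

section \<open>Matrices that are XOR permutations up to units\<close>

definition gaussian_ints :: "complex set" where
  "gaussian_ints = {z. Re z \<in> \<int> \<and> Im z \<in> \<int>}"

text \<open>The four units of the Gaussian integers, grouped by residue modulo 2: a sign is
  invisible there, while 1 and \<i> remain incongruent. The flag is the exponent of \<i> modulo
  2.\<close>

definition gauss_units :: "bool \<Rightarrow> complex set" where
  "gauss_units p = (if p then {\<i>, - \<i>} else {1, - 1})"

lemma gaussian_ints_closed [intro]:
  "x \<in> gaussian_ints \<Longrightarrow> y \<in> gaussian_ints \<Longrightarrow> x + y \<in> gaussian_ints"
  "x \<in> gaussian_ints \<Longrightarrow> y \<in> gaussian_ints \<Longrightarrow> x - y \<in> gaussian_ints"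
  "x \<in> gaussian_ints \<Longrightarrow> y \<in> gaussian_ints \<Longrightarrow> x * y \<in> gaussian_ints"
  by (auto simp: gaussian_ints_def)

lemma zero_gaussian_ints [simp]: "0 \<in> gaussian_ints"
  by (simp add: gaussian_ints_def)

lemma gauss_units_subset: "gauss_units p \<subseteq> gaussian_ints"
  by (auto simp: gauss_units_def gaussian_ints_def)

lemma gauss_units_mult:
  "u \<in> gauss_units p \<Longrightarrow> v \<in> gauss_units q \<Longrightarrow> u * v \<in> gauss_units (p \<noteq> q)"
  by (auto simp: gauss_units_def split: if_splits)

text \<open>Units of one class differ at most by a sign, so the difference is 0 or
  \<open>u * (z + z)\<close>. This is how 2-torsion makes signs disappear.\<close>

lemma gauss_units_congruent:
  assumes "u \<in> gauss_units p" "v \<in> gauss_units p" "z + z \<in> gaussian_ints"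
  shows "u * z - v * z \<in> gaussian_ints"
proof -
  have "u = v \<or> u = - v"
    using assms(1,2) by (auto simp: gauss_units_def split: if_splits)
  then have "u * z - v * z = 0 \<or> u * z - v * z = u * (z + z)"
    by (auto simp: algebra_simps)
  then show ?thesis
    using assms(1,3) gauss_units_subset[of p] by (metis gaussian_ints_closed(3) subsetD zero_gaussian_ints)
qed

text \<open>Some real or imaginary part equals 1/2 or -1/2. The two facts later separate different
  masks and different unit classes, respectively.\<close>

lemma half_gauss_unit_not_gaussian_int:
  "u \<in> gauss_units p \<Longrightarrow> u / 2 \<notin> gaussian_ints"
  "u \<in> gauss_units p \<Longrightarrow> v \<in> gauss_units q \<Longrightarrow> p \<noteq> q \<Longrightarrow> u / 2 - v / 2 \<notin> gaussian_ints"
proof -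
  have "(1 / 2 :: real) \<notin> \<int>" "(- (1 / 2) :: real) \<notin> \<int>"
    by (auto elim!: Ints_cases simp: field_simps)
  then show "u \<in> gauss_units p \<Longrightarrow> u / 2 \<notin> gaussian_ints"
    "u \<in> gauss_units p \<Longrightarrow> v \<in> gauss_units q \<Longrightarrow> p \<noteq> q \<Longrightarrow> u / 2 - v / 2 \<notin> gaussian_ints"
    by (auto simp: gauss_units_def gaussian_ints_def split: if_splits)
qed

section \<open>Monomial matrices over XOR translations, and their products\<close>

text \<open>The mask \<open>m\<close> gives a translation of (Z/2)^k, with indices read as bit
  strings. Only the class \<open>p\<close> of the nonzero entries is recorded, so signs may vary
  from column to column.\<close>

definition xor_monomial :: "nat \<Rightarrow> nat \<Rightarrow> bool \<Rightarrow> complex mat \<Rightarrow> bool" where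
  "xor_monomial k m p M \<longleftrightarrow> M \<in> carrier_mat (2 ^ k) (2 ^ k) \<and> m < 2 ^ k \<and>
     (\<forall>a<2 ^ k. \<forall>b<2 ^ k.
        M $$ (a, b) \<in> (if a = xor b m then gauss_units p else {0}))"

lemma xor_less_power:
  fixes a b :: nat
  assumes "a < 2 ^ k" "b < 2 ^ k"
  shows "xor a b < 2 ^ k"
  using assms by (metis take_bit_nat_eq_self_iff take_bit_xor)

lemma xor_cancel_right: "xor (xor a b) b = (a :: nat)"
  by (simp add: xor.assoc)

lemma xor_monomial_carrier: "xor_monomial k m p M \<Longrightarrow> M \<in> carrier_mat (2 ^ k) (2 ^ k)"
  and xor_monomial_less: "xor_monomial k m p M \<Longrightarrow> m < 2 ^ k"
  by (simp_all add: xor_monomial_def)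

lemma xor_monomial_unit:
  "xor_monomial k m p M \<Longrightarrow> b < 2 ^ k \<Longrightarrow> M $$ (xor b m, b) \<in> gauss_units p"
  using xor_less_power[of b k m] by (force simp: xor_monomial_def)

lemma xor_monomial_zero:
  "xor_monomial k m p M \<Longrightarrow> a < 2 ^ k \<Longrightarrow> b < 2 ^ k \<Longrightarrow> a \<noteq> xor b m \<Longrightarrow> M $$ (a, b) = 0"
  by (force simp: xor_monomial_def)

lemma xor_monomial_gaussian_ints:
  assumes "xor_monomial k m p M" "a < 2 ^ k" "b < 2 ^ k"
  shows "M $$ (a, b) \<in> gaussian_ints"
proof -
  have "M $$ (a, b) \<in> (if a = xor b m then gauss_units p else {0})"
    using assms by (simp add: xor_monomial_def)
  then show ?thesis
    using gauss_units_subset[of p] by (auto split: if_splits)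
qed

text \<open>XOR with \<open>m\<close> is its own inverse, so the one nonzero entry of row
  \<open>a\<close> sits in column \<open>xor a m\<close>.\<close>

lemma xor_monomial_mult_vec:
  assumes M: "xor_monomial k m p M" and v: "v \<in> carrier_vec (2 ^ k)" and a: "a < 2 ^ k"
  shows "(M *\<^sub>v v) $ a = M $$ (a, xor a m) * v $ xor a m"
proof -
  have am: "xor a m < 2 ^ k"
    using a xor_monomial_less[OF M] by (rule xor_less_power)
  have "(M *\<^sub>v v) $ a = (\<Sum>b = 0..<2 ^ k. M $$ (a, b) * v $ b)"
    using v a xor_monomial_carrier[OF M] by (simp add: scalar_prod_def)
  also have "\<dots> = (\<Sum>b\<in>{xor a m}. M $$ (a, b) * v $ b)"
  proof (rule sum.mono_neutral_right)
    show "\<forall>b\<in>{0..<2 ^ k} - {xor a m}. M $$ (a, b) * v $ b = 0"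
    proof
      fix b assume "b \<in> {0..<2 ^ k} - {xor a m}"
      moreover from this have "a \<noteq> xor b m"
        by (auto simp: xor_cancel_right)
      ultimately show "M $$ (a, b) * v $ b = 0"
        using xor_monomial_zero[OF M a] by simp
    qed
  qed (use am in auto)
  finally show ?thesis by simp
qed

text \<open>Translations compose by XOR of their masks, and exponents of \<i> add modulo 2, which on
  \<open>bool\<close> is \<open>\<noteq>\<close>. Hence the pairs of mask and class multiply like
  elements of (Z/2)^(k+1).\<close>

lemma xor_monomial_mult:
  assumes M: "xor_monomial k m p M" and N: "xor_monomial k n q N"
  shows "xor_monomial k (xor n m) (p \<noteq> q) (M * N)"
  unfolding xor_monomial_def
proof (intro conjI allI impI)
  note c = xor_monomial_carrier[OF M] xor_monomial_carrier[OF N]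
  show "M * N \<in> carrier_mat (2 ^ k) (2 ^ k)"
    using c by simp
  show "xor n m < 2 ^ k"
    using assms by (intro xor_less_power xor_monomial_less)
  fix a b :: nat
  assume a: "a < 2 ^ k" and b: "b < 2 ^ k"
  have am: "xor a m < 2 ^ k"
    using a xor_monomial_less[OF M] by (rule xor_less_power)
  \<comment> \<open>Reading the entry as \<open>M\<close> applied to a column of \<open>N\<close>
    lets the matrix-vector formula collapse the sum to one term.\<close>
  have "(M * N) $$ (a, b) = (M *\<^sub>v col N b) $ a"
    using c a b by simp
  also have "\<dots> = M $$ (a, xor a m) * N $$ (xor a m, b)"
    using c a b am by (subst xor_monomial_mult_vec[OF M]) auto
  finally have eq: "(M * N) $$ (a, b) = M $$ (a, xor a m) * N $$ (xor a m, b)" .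
  have iff: "a = xor b (xor n m) \<longleftrightarrow> xor a m = xor b n"
    by (metis xor.assoc xor_cancel_right)
  have "M $$ (a, xor a m) \<in> gauss_units p"
    using xor_monomial_unit[OF M am] by (simp add: xor_cancel_right)
  from gauss_units_mult[OF this xor_monomial_unit[OF N b]]
  show "(M * N) $$ (a, b) \<in> (if a = xor b (xor n m) then gauss_units (p \<noteq> q) else {0})"
    unfolding iff eq
    using xor_monomial_zero[OF N am b] by auto
qed

section \<open>Kronecker products of XOR-monomial matrices\<close>

text \<open>XOR works bit by bit, so it commutes with dropping or keeping the low \<open>l\<close>
  bits. The number \<open>m * 2 ^ l + n\<close> is the concatenation of the bits of \<open>m\<close>
  and \<open>n\<close>.\<close>

lemma xor_shift_add:
  fixes m n b :: nat
  assumes "n < 2 ^ l"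
  shows "xor b (m * 2 ^ l + n) div 2 ^ l = xor (b div 2 ^ l) m"
    and "xor b (m * 2 ^ l + n) mod 2 ^ l = xor (b mod 2 ^ l) n"
proof -
  have "xor b (m * 2 ^ l + n) div 2 ^ l = xor (b div 2 ^ l) ((m * 2 ^ l + n) div 2 ^ l)"
    by (simp only: flip: drop_bit_eq_div) simp
  then show "xor b (m * 2 ^ l + n) div 2 ^ l = xor (b div 2 ^ l) m"
    using assms by simp
  have "xor b (m * 2 ^ l + n) mod 2 ^ l = xor (b mod 2 ^ l) ((m * 2 ^ l + n) mod 2 ^ l)"
    by (simp only: flip: take_bit_eq_mod) simp
  then show "xor b (m * 2 ^ l + n) mod 2 ^ l = xor (b mod 2 ^ l) n"
    using assms by simp
qed

text \<open>A Kronecker index consists of high bits for the left factor and low bits for the right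
  one, so masks are concatenated while unit classes add.\<close>

lemma xor_monomial_kron:
  assumes M: "xor_monomial k m p M" and N: "xor_monomial l n q N"
  shows "xor_monomial (k + l) (m * 2 ^ l + n) (p \<noteq> q) (kron M N)"
  unfolding xor_monomial_def
proof (intro conjI allI impI)
  note c = xor_monomial_carrier[OF M] xor_monomial_carrier[OF N]
  note less = xor_monomial_less[OF M] xor_monomial_less[OF N]
  show "kron M N \<in> carrier_mat (2 ^ (k + l)) (2 ^ (k + l))"
    using c by (simp add: power_add)
  have "m * 2 ^ l + n < (m + 1) * 2 ^ l"
    using less(2) by simp
  also have "\<dots> \<le> 2 ^ k * 2 ^ l"
    using less(1) by (intro mult_right_mono) auto
  finally show "m * 2 ^ l + n < 2 ^ (k + l)"
    by (simp add: power_add)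
  fix a b :: nat
  assume "a < 2 ^ (k + l)" and "b < 2 ^ (k + l)"
  then have a: "a < 2 ^ k * 2 ^ l" and b: "b < 2 ^ k * 2 ^ l"
    by (simp_all add: power_add)
  note d = div_less_of_mult[OF a] mod_less_of_mult[OF a] div_less_of_mult[OF b] mod_less_of_mult[OF b]
  have "a = xor b (m * 2 ^ l + n) \<longleftrightarrow>
      a div 2 ^ l = xor b (m * 2 ^ l + n) div 2 ^ l \<and> a mod 2 ^ l = xor b (m * 2 ^ l + n) mod 2 ^ l"
    by (metis div_mult_mod_eq)
  then have iff: "a = xor b (m * 2 ^ l + n) \<longleftrightarrow>
      a div 2 ^ l = xor (b div 2 ^ l) m \<and> a mod 2 ^ l = xor (b mod 2 ^ l) n"
    by (simp only: xor_shift_add[OF less(2)])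
  show "kron M N $$ (a, b) \<in> (if a = xor b (m * 2 ^ l + n) then gauss_units (p \<noteq> q) else {0})"
    unfolding index_kron[OF c a b] iff
    using gauss_units_mult[OF xor_monomial_unit[OF M d(3)] xor_monomial_unit[OF N d(4)]]
      xor_monomial_zero[OF M d(1,3)] xor_monomial_zero[OF N d(2,4)]
    by auto
qed

section \<open>Masks and unit classes of the spin generators and words\<close>

lemma xor_monomial_one: "xor_monomial k 0 False (1\<^sub>m (2 ^ k))"
  by (auto simp: xor_monomial_def gauss_units_def)

lemma xor_monomial_blocks:
  "xor_monomial 1 0 True E1_mat" "xor_monomial 1 1 True E2_mat" "xor_monomial 1 1 True B_mat"
  by (auto simp: xor_monomial_def gauss_units_def E1_mat_def E2_mat_def B_mat_def
      mat_of_rows_list_def numeral_2_eq_2 less_Suc_eq)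

lemma xor_monomial_B_pow: "xor_monomial n (2 ^ n - 1) (odd n) (kron_pow B_mat n)"
proof (induction n)
  case 0
  then show ?case
    using xor_monomial_one[of 0] by simp
next
  case (Suc n)
  have "2 ^ n + (2 ^ n - 1) = 2 * 2 ^ n - (1 :: nat)"
    by simp
  with xor_monomial_kron[OF xor_monomial_blocks(3) Suc.IH] show ?case
    by simp
qed

text \<open>With \<open>j = (m + 1) div 2\<close>, the identity factors give leading zero bits and
  each of the \<open>j - 1\<close> factors \<open>B_mat\<close> gives a one. \<open>E1_mat\<close>
  adds a zero and \<open>E2_mat\<close> a one, so there are \<open>m div 2\<close> ones in either
  case. The \<open>j\<close> factors other than the identity each contribute one \<i>.\<close>

lemma xor_monomial_spin_gen:
  assumes "m \<in> {1..2 * k}"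
  shows "xor_monomial k (2 ^ (m div 2) - 1) (odd ((m + 1) div 2)) (spin_gen k m)"
proof -
  define j where "j = (m + 1) div 2"
  have j: "1 \<le> j" "j \<le> k"
    using assms by (auto simp: j_def)
  have blk: "xor_monomial 1 (if odd m then 0 else 1) True (spin_block m)"
    using xor_monomial_blocks by simp
  have "xor_monomial (1 + (j - 1)) ((if odd m then 0 else 1) * 2 ^ (j - 1) + (2 ^ (j - 1) - 1))
      (True \<noteq> odd (j - 1)) (kron (spin_block m) (kron_pow B_mat (j - 1)))"
    by (rule xor_monomial_kron[OF blk xor_monomial_B_pow])
  from xor_monomial_kron[OF xor_monomial_one[of "k - j"] this]
  have "xor_monomial (k - j + (1 + (j - 1)))
      ((if odd m then 0 else 1) * 2 ^ (j - 1) + (2 ^ (j - 1) - 1)) (\<not> odd (j - 1))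
      (kron (1\<^sub>m (2 ^ (k - j))) (kron (spin_block m) (kron_pow B_mat (j - 1))))"
    by (simp only: mult_zero_left add_0_left simp_thms)
  moreover have "k - j + (1 + (j - 1)) = k" "(\<not> odd (j - 1)) = odd j"
    using j by auto
  moreover have "kron (1\<^sub>m (2 ^ (k - j))) (kron (spin_block m) (kron_pow B_mat (j - 1))) = spin_gen k m"
    by (simp only: spin_gen_def Let_def j_def kron_pow_one)
  ultimately have X: "xor_monomial k ((if odd m then 0 else 1) * 2 ^ (j - 1) + (2 ^ (j - 1) - 1))
      (odd j) (spin_gen k m)"
    by (simp only:)
  have "(if odd m then 0 else 1) * 2 ^ (j - 1) + (2 ^ (j - 1) - 1) = 2 ^ (m div 2) - (1 :: nat)"
  proof (cases "odd m")
    case True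
    then have "j - 1 = m div 2" by (auto simp: j_def elim!: oddE)
    with True show ?thesis by simp
  next
    case False
    then have m: "m div 2 = Suc (j - 1)" using j by (auto simp: j_def elim!: evenE)
    show ?thesis using False unfolding m by simp
  qed
  with X show ?thesis
    by (simp only: j_def)
qed

lemma xor_monomial_spin_word:
  "set \<mu> \<subseteq> {1..2 * k} \<Longrightarrow> \<exists>m p. xor_monomial k m p (spin_word k \<mu>)"
proof (induction \<mu>)
  case Nil
  then show ?case
    using xor_monomial_one[of k] by (auto simp: spin_word_def)
next
  case (Cons l \<mu>)
  then obtain m p where "xor_monomial k m p (spin_word k \<mu>)"
    by auto
  moreover have "xor_monomial k (2 ^ (l div 2) - 1) (odd ((l + 1) div 2)) (spin_gen k l)"
    using Cons.prems by (intro xor_monomial_spin_gen) auto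
  ultimately show ?case
    using xor_monomial_mult by (fastforce simp: spin_word_def)
qed

section \<open>Realising every mask and class by an increasing sequence\<close>

lemma spin_word_snoc:
  assumes "set \<mu> \<subseteq> {1..2 * k}" "l \<in> {1..2 * k}"
  shows "spin_word k (\<mu> @ [l]) = spin_word k \<mu> * spin_gen k l"
  using spin_word_append[OF assms(1), of "[l]"] assms(2) right_mult_one_mat[OF spin_gen_carrier[OF assms(2)]]
  by (simp add: spin_word_def)

text \<open>The hypotheses say that bit \<open>j\<close> is the leading bit of \<open>m\<close>. XOR
  with \<open>j + 1\<close> ones flips it to zero.\<close>

lemma xor_mask_less:
  fixes m :: nat
  assumes "m < 2 ^ Suc j" "\<not> m < 2 ^ j"
  shows "xor m (2 ^ Suc j - 1) < 2 ^ j"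
proof -
  have "m = 1 * 2 ^ j + (m - 2 ^ j)" "m - 2 ^ j < 2 ^ j"
    using assms by auto
  then have "m div 2 ^ j = 1"
    by (metis div_mult_self3 div_less add.right_neutral power_not_zero zero_neq_numeral)
  \<comment> \<open>The mask \<open>2 ^ Suc j - 1\<close> is split into its leading one and
    \<open>j\<close> further ones, so that the high part can be computed separately.\<close>
  moreover have "xor m (1 * 2 ^ j + (2 ^ j - 1)) div 2 ^ j = xor (m div 2 ^ j) 1"
    by (rule xor_shift_add) simp
  ultimately have "xor m (2 ^ Suc j - 1) div 2 ^ j = 0"
    by (simp add: mult_2)
  then show ?thesis
    by (simp add: div_eq_0_iff)
qed

text \<open>Induction on the number \<open>j\<close> of letter pairs available, with the matrix size
  fixed by \<open>k\<close>. For \<open>j = 1\<close> the words \<open>[]\<close>,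
  \<open>[1]\<close>, \<open>[2]\<close>, \<open>[1, 2]\<close> give all four pairs. Each later step
  appends the letter \<open>2 * Suc j\<close> exactly when the new leading bit of the mask is
  set.\<close>

lemma xor_monomial_realised:
  assumes "1 \<le> j" "j \<le> k" "m < 2 ^ j"
  shows "\<exists>\<mu>\<in>increasing_seqs (2 * j). xor_monomial k m p (spin_word k \<mu>)"
  using assms
proof (induction j arbitrary: m p rule: nat_induct_at_least)
  case base
  have g: "xor_monomial k 0 True (spin_gen k 1)" "xor_monomial k 1 True (spin_gen k 2)"
    using xor_monomial_spin_gen[of 1 k] xor_monomial_spin_gen[of 2 k] base.prems by auto
  have e: "xor_monomial k 0 False (spin_word k [])"
    using xor_monomial_one[of k] by (simp add: spin_word_def)
  have w: "spin_word k [l] = spin_gen k l" if "l \<in> {1..2 * k}" for l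
    using right_mult_one_mat[OF spin_gen_carrier[OF that]] by (simp add: spin_word_def)
  have "spin_word k [1, 2] = spin_gen k 1 * spin_gen k 2"
    using spin_word_snoc[of "[1]" k 2] w[of 1] base.prems by simp
  then have "xor_monomial k 1 False (spin_word k [1, 2])"
    using xor_monomial_mult[OF g] by simp
  moreover have "xor_monomial k 0 True (spin_word k [1])" "xor_monomial k 1 True (spin_word k [2])"
    using g w[of 1] w[of 2] base.prems by auto
  moreover have "[] \<in> increasing_seqs (2 * 1)" "[1] \<in> increasing_seqs (2 * 1)"
    "[2] \<in> increasing_seqs (2 * 1)" "[1, 2] \<in> increasing_seqs (2 * 1)"
    by (auto simp: increasing_seqs_def)
  moreover have "m = 0 \<or> m = 1"
    using base.prems by auto
  ultimately show ?case
    using e by (cases p; elim disjE) (simp; blast)+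
next
  case (Suc j)
  have mono: "increasing_seqs (2 * j) \<subseteq> increasing_seqs (2 * Suc j)"
    by (auto simp: increasing_seqs_def)
  show ?case
  proof (cases "m < 2 ^ j")
    case True
    then show ?thesis
      using Suc.IH[of m p] Suc.prems mono by auto
  next
    case False
    let ?x = "2 ^ Suc j - 1 :: nat" and ?l = "2 * Suc j"
    \<comment> \<open>The new generator has mask \<open>?x\<close> and class
      \<open>odd (Suc j)\<close>. Both are cancelled in advance from the target, so multiplying by
      it restores \<open>m\<close> and \<open>p\<close>.\<close>
    obtain \<mu> where \<mu>: "\<mu> \<in> increasing_seqs (2 * j)"
      "xor_monomial k (xor m ?x) (p \<noteq> odd (Suc j)) (spin_word k \<mu>)"
      using Suc.IH[OF _ xor_mask_less[OF Suc.prems(2) False]] Suc.prems(1) by (meson Suc_leD)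
    have l: "?l \<in> {1..2 * k}" and s: "set \<mu> \<subseteq> {1..2 * k}"
      using Suc.prems(1) \<mu>(1) by (auto simp: increasing_seqs_def)
    have "(?l + 1) div 2 = Suc j" "?l div 2 = Suc j"
      by auto
    then have "xor_monomial k ?x (odd (Suc j)) (spin_gen k ?l)"
      using xor_monomial_spin_gen[OF l] by metis
    from xor_monomial_mult[OF \<mu>(2) this]
    have "xor_monomial k (xor ?x (xor m ?x)) ((p \<noteq> odd (Suc j)) \<noteq> odd (Suc j)) (spin_word k (\<mu> @ [?l]))"
      unfolding spin_word_snoc[OF s l] .
    moreover have "xor ?x (xor m ?x) = m"
      by (metis xor.commute xor_cancel_right)
    moreover have "((p \<noteq> odd (Suc j)) \<noteq> odd (Suc j)) = p"
      by blast
    moreover have "\<mu> @ [?l] \<in> increasing_seqs (2 * Suc j)"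
      using \<mu>(1) by (fastforce simp: increasing_seqs_def sorted_wrt_append)
    ultimately show ?thesis
      by (simp only:) blast
  qed
qed


section \<open>The 2-torsion points of the torus\<close>

lemma gaussian_lattice_altdef:
  "gaussian_lattice n = {v \<in> carrier_vec n. \<forall>a<n. v $ a \<in> gaussian_ints}"
  by (simp add: gaussian_lattice_def gaussian_ints_def)

lemma gaussian_lattice_normal:
  "gaussian_lattice n \<lhd> monoid_vec TYPE(complex) n"
proof -
  interpret G: comm_group "monoid_vec TYPE(complex) n"
    by (rule comm_group_vec)
  have inv: "inv\<^bsub>monoid_vec TYPE(complex) n\<^esub> v = - v" if "v \<in> carrier_vec n" for v
    by (rule G.inv_equality) (use that in \<open>auto simp: monoid_vec_simps\<close>)
  have "subgroup (gaussian_lattice n) (monoid_vec TYPE(complex) n)"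
    by (rule G.subgroupI)
      (auto simp: monoid_vec_simps inv gaussian_lattice_def intro!: exI[of _ "0\<^sub>v n"])
  then show ?thesis
    by (rule G.subgroup_imp_normal)
qed

abbreviation lattice_coset :: "nat \<Rightarrow> complex vec \<Rightarrow> complex vec set" where
  "lattice_coset k v \<equiv> gaussian_lattice (2 ^ k) #>\<^bsub>monoid_vec TYPE(complex) (2 ^ k)\<^esub> v"

text \<open>Turns equality of points of the torus into an entrywise integrality test.\<close>

lemma lattice_coset_eq_iff:
  assumes "v \<in> carrier_vec (2 ^ k)" "w \<in> carrier_vec (2 ^ k)"
  shows "lattice_coset k v = lattice_coset k w \<longleftrightarrow> v - w \<in> gaussian_lattice (2 ^ k)"
proof -
  interpret normal "gaussian_lattice (2 ^ k)" "monoid_vec TYPE(complex) (2 ^ k)"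
    by (rule gaussian_lattice_normal)
  have "v \<in> lattice_coset k w \<longleftrightarrow> v - w \<in> gaussian_lattice (2 ^ k)"
  proof
    assume "v \<in> lattice_coset k w"
    then obtain l where l: "l \<in> gaussian_lattice (2 ^ k)" "v = l + w"
      by (auto simp: r_coset_def monoid_vec_simps)
    have "v - w = l"
      by (rule eq_vecI) (use l assms in \<open>auto simp: gaussian_lattice_def\<close>)
    with l show "v - w \<in> gaussian_lattice (2 ^ k)" by simp
  next
    assume l: "v - w \<in> gaussian_lattice (2 ^ k)"
    have "v = (v - w) + w"
      by (rule eq_vecI) (use assms in auto)
    with l show "v \<in> lattice_coset k w"
      by (auto simp: r_coset_def monoid_vec_simps)
  qed
  moreover have "v \<in> lattice_coset k w \<longleftrightarrow> lattice_coset k v = lattice_coset k w"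
    using repr_independence[of v "gaussian_lattice (2 ^ k)" w]
      repr_independenceD[of "gaussian_lattice (2 ^ k)" v w] assms subgroup_axioms
    by (auto simp: monoid_vec_simps)
  ultimately show ?thesis by simp
qed

text \<open>The quotient group is written multiplicatively, so squaring a coset doubles its
  representative.\<close>

lemma two_torsion_spin_torus:
  "two_torsion (spin_torus k) =
     {lattice_coset k v |v. v \<in> carrier_vec (2 ^ k) \<and> v + v \<in> gaussian_lattice (2 ^ k)}"
proof -
  interpret normal "gaussian_lattice (2 ^ k)" "monoid_vec TYPE(complex) (2 ^ k)"
    by (rule gaussian_lattice_normal)
  interpret Q: Group.group "spin_torus k"
    unfolding spin_torus_def by (rule factorgroup_is_group)
  have carrier: "carrier (spin_torus k) = {lattice_coset k v |v. v \<in> carrier_vec (2 ^ k)}"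
    by (auto simp: spin_torus_def FactGroup_def RCOSETS_def monoid_vec_simps)
  have "lattice_coset k v [^]\<^bsub>spin_torus k\<^esub> (2::nat) = \<one>\<^bsub>spin_torus k\<^esub> \<longleftrightarrow>
      v + v \<in> gaussian_lattice (2 ^ k)" if v: "v \<in> carrier_vec (2 ^ k)" for v
  proof -
    have "lattice_coset k v \<in> carrier (spin_torus k)"
      using v carrier by auto
    then have "lattice_coset k v [^]\<^bsub>spin_torus k\<^esub> (2::nat) =
        lattice_coset k v \<otimes>\<^bsub>spin_torus k\<^esub> lattice_coset k v"
      by (simp add: numeral_2_eq_2)
    also have "\<dots> = lattice_coset k (v + v)"
      using rcos_sum[of v v] v by (simp add: spin_torus_def FactGroup_def monoid_vec_simps)
    finally have "lattice_coset k v [^]\<^bsub>spin_torus k\<^esub> (2::nat) = lattice_coset k (v + v)" .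
    \<comment> \<open>The neutral element is the lattice itself; as the coset of zero it fits the
      criterion for equality of cosets.\<close>
    moreover have "\<one>\<^bsub>spin_torus k\<^esub> = lattice_coset k (0\<^sub>v (2 ^ k))"
      using coset_join2[OF _ subgroup_axioms subgroup.one_closed[OF subgroup_axioms]]
      by (simp add: spin_torus_def FactGroup_def monoid_vec_simps)
    moreover have "v + v - 0\<^sub>v (2 ^ k) = v + v"
      by (rule eq_vecI) (use v in auto)
    ultimately show ?thesis
      using lattice_coset_eq_iff[of "v + v" k "0\<^sub>v (2 ^ k)"] v by simp
  qed
  then show ?thesis
    unfolding two_torsion_def carrier by blast
qed

section \<open>The action of XOR-monomial matrices on 2-torsion points\<close>

lemma xor_monomial_torus_act:
  assumes "xor_monomial k m p M" "v \<in> carrier_vec (2 ^ k)"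
  shows "torus_act k M (lattice_coset k v) = lattice_coset k (M *\<^sub>v v)"
  using xor_monomial_gaussian_ints[OF assms(1)]
  by (intro torus_act_coset xor_monomial_carrier[OF assms(1)] assms(2))
    (auto simp: gaussian_ints_def)

text \<open>In each row both products multiply the same entry of \<open>v\<close> by units of one
  class. Since twice that entry is a Gaussian integer, \<open>gauss_units_congruent\<close>
  applies.\<close>

lemma xor_monomial_coset_eq:
  assumes M: "xor_monomial k m p M" and N: "xor_monomial k m p N"
    and v: "v \<in> carrier_vec (2 ^ k)" "v + v \<in> gaussian_lattice (2 ^ k)"
  shows "lattice_coset k (M *\<^sub>v v) = lattice_coset k (N *\<^sub>v v)"
proof -
  have c: "M *\<^sub>v v \<in> carrier_vec (2 ^ k)" "N *\<^sub>v v \<in> carrier_vec (2 ^ k)"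
    using xor_monomial_carrier[OF M] xor_monomial_carrier[OF N] v by auto
  have "(M *\<^sub>v v - N *\<^sub>v v) $ a \<in> gaussian_ints" if a: "a < 2 ^ k" for a
  proof -
    have am: "xor a m < 2 ^ k"
      using a xor_monomial_less[OF M] by (rule xor_less_power)
    have "v $ xor a m + v $ xor a m \<in> gaussian_ints"
      using v am by (auto simp: gaussian_lattice_altdef)
    moreover have "M $$ (a, xor a m) \<in> gauss_units p" "N $$ (a, xor a m) \<in> gauss_units p"
      using xor_monomial_unit[OF M am] xor_monomial_unit[OF N am] by (simp_all add: xor_cancel_right)
    ultimately show ?thesis
      using xor_monomial_carrier[OF M] xor_monomial_carrier[OF N] a
      by (simp add: xor_monomial_mult_vec[OF M v(1) a] xor_monomial_mult_vec[OF N v(1) a]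
          gauss_units_congruent)
  qed
  then show ?thesis
    unfolding lattice_coset_eq_iff[OF c] using c by (simp add: gaussian_lattice_altdef)
qed

lemma xor_monomial_two_torsion:
  assumes M: "xor_monomial k m p M" and v: "v \<in> carrier_vec (2 ^ k)" "v + v \<in> gaussian_lattice (2 ^ k)"
  shows "M *\<^sub>v v + M *\<^sub>v v \<in> gaussian_lattice (2 ^ k)"
proof -
  have c: "M *\<^sub>v v \<in> carrier_vec (2 ^ k)"
    using xor_monomial_carrier[OF M] v by auto
  have "(M *\<^sub>v v + M *\<^sub>v v) $ a \<in> gaussian_ints" if a: "a < 2 ^ k" for a
  proof -
    have am: "xor a m < 2 ^ k"
      using a xor_monomial_less[OF M] by (rule xor_less_power)
    have "v $ xor a m + v $ xor a m \<in> gaussian_ints"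
      using v am by (auto simp: gaussian_lattice_altdef)
    then have "M $$ (a, xor a m) * (v $ xor a m + v $ xor a m) \<in> gaussian_ints"
      using xor_monomial_gaussian_ints[OF M a am] by auto
    then show ?thesis
      using xor_monomial_carrier[OF M] a
      by (simp add: xor_monomial_mult_vec[OF M v(1) a] ac_simps)
  qed
  then show ?thesis
    using c by (simp add: gaussian_lattice_altdef)
qed

text \<open>The square \<open>M * M\<close> has mask \<open>xor m m = 0\<close> and trivial class,
  the same data as the identity matrix, so both act alike on 2-torsion.\<close>

lemma involution_on_xor_monomial:
  assumes M: "xor_monomial k m p M"
  shows "involution_on (two_torsion (spin_torus k)) (restrict (torus_act k M) (two_torsion (spin_torus k)))"
  unfolding involution_on_def
proof (intro conjI ballI funcsetI)
  have tt: "torus_act k M X \<in> two_torsion (spin_torus k) \<and> torus_act k M (torus_act k M X) = X"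
    if X: "X \<in> two_torsion (spin_torus k)" for X
  proof -
    from X obtain v where v: "X = lattice_coset k v" "v \<in> carrier_vec (2 ^ k)"
      "v + v \<in> gaussian_lattice (2 ^ k)"
      by (auto simp: two_torsion_spin_torus)
    have c: "M *\<^sub>v v \<in> carrier_vec (2 ^ k)"
      using xor_monomial_carrier[OF M] v by auto
    have "torus_act k M (torus_act k M X) = lattice_coset k (M *\<^sub>v (M *\<^sub>v v))"
      using v c by (simp add: xor_monomial_torus_act[OF M])
    also have "M *\<^sub>v (M *\<^sub>v v) = (M * M) *\<^sub>v v"
      using xor_monomial_carrier[OF M] v(2) by simp
    also have "lattice_coset k ((M * M) *\<^sub>v v) = lattice_coset k (1\<^sub>m (2 ^ k) *\<^sub>v v)"
    proof (rule xor_monomial_coset_eq[OF _ xor_monomial_one v(2,3)])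
      show "xor_monomial k 0 False (M * M)"
        using xor_monomial_mult[OF M M] by simp
    qed
    finally have "torus_act k M (torus_act k M X) = X"
      using v by simp
    moreover have "torus_act k M X \<in> two_torsion (spin_torus k)"
      using v c xor_monomial_two_torsion[OF M v(2,3)]
      by (auto simp: xor_monomial_torus_act[OF M] two_torsion_spin_torus)
    ultimately show ?thesis by blast
  qed
  fix X assume "X \<in> two_torsion (spin_torus k)"
  then show "restrict (torus_act k M) (two_torsion (spin_torus k)) X \<in> two_torsion (spin_torus k)"
    and "restrict (torus_act k M) (two_torsion (spin_torus k))
        (restrict (torus_act k M) (two_torsion (spin_torus k)) X) = X"
    using tt[of X] by auto
qed

text \<open>This reduces counting maps to counting pairs of a mask and a class.\<close>

lemma restrict_torus_act_eq_iff:
  assumes M: "xor_monomial k m p M" and N: "xor_monomial k n q N"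
  shows "restrict (torus_act k M) (two_torsion (spin_torus k)) =
      restrict (torus_act k N) (two_torsion (spin_torus k)) \<longleftrightarrow> m = n \<and> p = q"
    (is "?f = ?g \<longleftrightarrow> _")
proof
  assume "m = n \<and> p = q"
  then have N: "xor_monomial k m p N"
    using N by simp
  show "?f = ?g"
    by (rule restrict_ext)
      (auto simp: two_torsion_spin_torus xor_monomial_torus_act[OF M] xor_monomial_torus_act[OF N]
        xor_monomial_coset_eq[OF M N])
next
  assume eq: "?f = ?g"
  \<comment> \<open>Half the first basis vector picks out the first columns of the matrices modulo 2.\<close>
  define v :: "complex vec" where "v = (1 / 2) \<cdot>\<^sub>v unit_vec (2 ^ k) 0"
  have v: "v \<in> carrier_vec (2 ^ k)" "v + v \<in> gaussian_lattice (2 ^ k)"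
    by (auto simp: v_def gaussian_lattice_def unit_vec_def)
  then have "lattice_coset k v \<in> two_torsion (spin_torus k)"
    by (auto simp: two_torsion_spin_torus)
  with eq have "lattice_coset k (M *\<^sub>v v) = lattice_coset k (N *\<^sub>v v)"
    by (metis restrict_apply' xor_monomial_torus_act[OF M v(1)] xor_monomial_torus_act[OF N v(1)])
  moreover have c: "M *\<^sub>v v \<in> carrier_vec (2 ^ k)" "N *\<^sub>v v \<in> carrier_vec (2 ^ k)"
    using xor_monomial_carrier[OF M] xor_monomial_carrier[OF N] v by auto
  ultimately have "M *\<^sub>v v - N *\<^sub>v v \<in> gaussian_lattice (2 ^ k)"
    by (simp add: lattice_coset_eq_iff)
  then have diff: "(M *\<^sub>v v) $ a - (N *\<^sub>v v) $ a \<in> gaussian_ints" if "a < 2 ^ k" for a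
    using that xor_monomial_carrier[OF M] xor_monomial_carrier[OF N]
    by (auto simp: gaussian_lattice_altdef)
  have col: "(A *\<^sub>v v) $ a = A $$ (a, 0) / 2" if "a < 2 ^ k" "A \<in> carrier_mat (2 ^ k) (2 ^ k)"
    for A a
    using that by (simp add: v_def mult_mat_vec)
  have diff: "M $$ (a, 0) / 2 - N $$ (a, 0) / 2 \<in> gaussian_ints" if "a < 2 ^ k" for a
    using diff[OF that] col[OF that] xor_monomial_carrier[OF M] xor_monomial_carrier[OF N] by simp
  have 0: "(0::nat) < 2 ^ k" by simp
  have Mm: "M $$ (m, 0) \<in> gauss_units p"
    using xor_monomial_unit[OF M 0] by simp
  \<comment> \<open>Row \<open>m\<close> is the test row: for different masks the entry of
    \<open>N\<close> there is 0 and half a unit remains. Once the masks agree, the same row compares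
    halves of two units and forces equal classes.\<close>
  have "m = n"
  proof (rule ccontr)
    assume "m \<noteq> n"
    then have "N $$ (m, 0) = 0"
      using xor_monomial_zero[OF N xor_monomial_less[OF M] 0] by simp
    with diff[OF xor_monomial_less[OF M]] half_gauss_unit_not_gaussian_int(1)[OF Mm]
    show False by simp
  qed
  moreover from this have "N $$ (m, 0) \<in> gauss_units q"
    using xor_monomial_unit[OF N 0] by simp
  then have "p = q"
    using half_gauss_unit_not_gaussian_int(2)[OF Mm] diff[OF xor_monomial_less[OF M]] by blast
  ultimately show "m = n \<and> p = q" ..
qed


section \<open>Counting the maps\<close>

text \<open>Passes from products in the quotient algebra to explicit matrix products through the
  homomorphism \<open>spin_rep\<close>.\<close>

lemma spin_rep_clifford_prod:
  assumes "set \<mu> \<subseteq> {1..2 * k}"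
  shows "spin_rep k (clifford_prod (2 * k) \<mu>) = spin_word k \<mu>"
proof -
  interpret C: ring "clifford (2 * k)"
    by (rule ring_clifford)
  interpret I: ideal "clifford_ideal (2 * k)" "free_alg (2 * k)"
    by (rule ideal_clifford_ideal)
  note hom = spin_rep_hom[of k]
  have gen: "clifford_gen (2 * k) j \<in> carrier (clifford (2 * k))" if "j \<in> {1..2 * k}" for j
    using free_gen_closed[OF that]
    by (auto simp: clifford_gen_def clifford_def FactRing_def A_RCOSETS_def')
  \<comment> \<open>Membership in the carrier is carried through the induction because
    multiplicativity of \<open>spin_rep\<close> holds only there.\<close>
  have "clifford_prod (2 * k) \<mu> \<in> carrier (clifford (2 * k)) \<and>
      spin_rep k (clifford_prod (2 * k) \<mu>) = spin_word k \<mu>"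
    using assms
  proof (induction \<mu>)
    case Nil
    then show ?case
      using ring_hom_one[OF hom] by (simp add: clifford_prod_def spin_word_def ring_mat_simps)
  next
    case (Cons j \<mu>)
    then have j: "j \<in> {1..2 * k}" and IH: "clifford_prod (2 * k) \<mu> \<in> carrier (clifford (2 * k))"
      "spin_rep k (clifford_prod (2 * k) \<mu>) = spin_word k \<mu>"
      by auto
    have "clifford_prod (2 * k) (j # \<mu>) = clifford_gen (2 * k) j \<otimes>\<^bsub>clifford (2 * k)\<^esub> clifford_prod (2 * k) \<mu>"
      "spin_word k (j # \<mu>) = spin_gen k j * spin_word k \<mu>"
      by (simp_all add: clifford_prod_def spin_word_def)
    then show ?case
      using IH gen[OF j] ring_hom_mult[OF hom gen[OF j] IH(1)] spin_rep_gen[OF j]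
      by (simp add: ring_mat_simps)
  qed
  then show ?thesis ..
qed

lemma clifford_map_eq:
  "\<mu> \<in> increasing_seqs (2 * k) \<Longrightarrow>
     clifford_map k \<mu> = restrict (torus_act k (spin_word k \<mu>)) (two_torsion (spin_torus k))"
  by (simp add: clifford_map_def spin_rep_clifford_prod increasing_seqs_def)

theorem theorem3p6:
  fixes k :: nat
  assumes "k \<ge> 1"
  shows "(\<forall>\<mu>\<in>increasing_seqs (2 * k).
            involution_on (two_torsion (spin_torus k)) (clifford_map k \<mu>)) \<and>
         card {clifford_map k \<mu> |\<mu>. \<mu> \<in> increasing_seqs (2 * k)} = 2 ^ (k + 1)"
proof
  have mono: "\<exists>m p. xor_monomial k m p (spin_word k \<mu>)" if "\<mu> \<in> increasing_seqs (2 * k)" for \<mu>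
    using that xor_monomial_spin_word by (simp add: increasing_seqs_def)
  show "\<forall>\<mu>\<in>increasing_seqs (2 * k). involution_on (two_torsion (spin_torus k)) (clifford_map k \<mu>)"
  proof
    fix \<mu> assume \<mu>: "\<mu> \<in> increasing_seqs (2 * k)"
    with mono obtain m p where "xor_monomial k m p (spin_word k \<mu>)"
      by blast
    then show "involution_on (two_torsion (spin_torus k)) (clifford_map k \<mu>)"
      unfolding clifford_map_eq[OF \<mu>] by (rule involution_on_xor_monomial)
  qed
  \<comment> \<open>The index set of pairs: \<open>k\<close> bits of mask and one bit of class,
    hence \<open>2 ^ (k + 1)\<close> elements.\<close>
  let ?D = "{..<2 ^ k :: nat} \<times> (UNIV :: bool set)"
  have "\<forall>x\<in>?D. \<exists>\<mu>. \<mu> \<in> increasing_seqs (2 * k) \<and> xor_monomial k (fst x) (snd x) (spin_word k \<mu>)"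
    using xor_monomial_realised[OF assms order_refl] by auto
  then obtain w where w: "\<And>x. x \<in> ?D \<Longrightarrow> w x \<in> increasing_seqs (2 * k)"
    "\<And>x. x \<in> ?D \<Longrightarrow> xor_monomial k (fst x) (snd x) (spin_word k (w x))"
    by metis
  have "bij_betw (\<lambda>x. clifford_map k (w x)) ?D {clifford_map k \<mu> |\<mu>. \<mu> \<in> increasing_seqs (2 * k)}"
  proof (rule bij_betw_imageI)
    show "inj_on (\<lambda>x. clifford_map k (w x)) ?D"
    proof (rule inj_onI)
      fix x y assume x: "x \<in> ?D" and y: "y \<in> ?D" and "clifford_map k (w x) = clifford_map k (w y)"
      then show "x = y"
        using restrict_torus_act_eq_iff[OF w(2)[OF x] w(2)[OF y]]
        by (simp add: clifford_map_eq w(1) prod_eq_iff)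
    qed
    \<comment> \<open>An arbitrary sequence induces the same map as the chosen representative
      \<open>w (m, p)\<close> of its own mask and class.\<close>
    have "clifford_map k \<mu> \<in> (\<lambda>x. clifford_map k (w x)) ` ?D" if \<mu>: "\<mu> \<in> increasing_seqs (2 * k)" for \<mu>
    proof -
      obtain m p where mp: "xor_monomial k m p (spin_word k \<mu>)"
        using mono[OF \<mu>] by blast
      then have D: "(m, p) \<in> ?D"
        using xor_monomial_less by auto
      have "clifford_map k \<mu> = clifford_map k (w (m, p))"
        using restrict_torus_act_eq_iff[OF mp w(2)[OF D]]
        by (simp add: clifford_map_eq \<mu> w(1)[OF D])
      with D show ?thesis by blast
    qed
    then show "(\<lambda>x. clifford_map k (w x)) ` ?D = {clifford_map k \<mu> |\<mu>. \<mu> \<in> increasing_seqs (2 * k)}"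
      using w(1) by blast
  qed
  then have "card {clifford_map k \<mu> |\<mu>. \<mu> \<in> increasing_seqs (2 * k)} = card ?D"
    by (rule bij_betw_same_card[symmetric])
  then show "card {clifford_map k \<mu> |\<mu>. \<mu> \<in> increasing_seqs (2 * k)} = 2 ^ (k + 1)"
    by (simp add: card_cartesian_product)
qed

end
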